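(* For any family $\mathscr{F}$ of subsets of a set $X$, $$\eta(X,\mathscr{F})\leq 1+\tau'(X,\mathscr{F}).$$ In particular, if $\tau'(X,\mathscr{F})=\tau(X,\mathscr{F})-1$, then $\eta(X,\mathscr{F})=1+\tau'(X,\mathscr{F})=\tau(X,\mathscr{F})$.
   Context: The colorful Helly number $\eta(X,\mathscr{F})$ is the minimum positive integer $\eta$ for which the following holds: if finite subfamilies $\mathscr{F}_1,\ldots,\mathscr{F}_\eta\subset\mathscr{F}$ are such that $\bigcap_{F\in\mathscr{F}_i}F=\emptyset$ for every $i=1,\ldots,\eta$, then there exist $F_i\in\mathscr{F}_i$ ($1\le i\le\eta$) such that $F_1\cap\cdots\cap F_\eta=\emptyset$. If no such integer exists, $\eta(X,\mathscr{F})=\infty$. The comatching number $\tau(X,\mathscr{F})$ is the maximum size of an induced matching in the bipartite graph on $X\cup\mathscr{F}$ in which $(x,F)\in X\times\mathscr{F}$ is an edge if $x\notin F$; i.e. the largest $k$ such that there exist $x_1,\ldots,x_k\in X$ and $F_1,\ldots,F_k\in\mathscr{F}$ with $x_i\in F_j$ if and only if $i\ne j$ (for all $i,j\in\{1,\ldots,k\}$). The number $\tau'(X,\mathscr{F})$ is the largest $k$ such that there exist $x_1,\ldots,x_{k+1}\in X$ and $F_1,\ldots,F_k\in\mathscr{F}$ with $x_i\in F_j$ if and only if $i\neq j$ (for all $1\le i\le k+1$, $1\le j\le k$); in particular $x_{k+1}$ lies in all of $F_1,\ldots,F_k$. *)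

theory Defs
  imports Main "HOL-Library.Extended_Nat"
begin

text \<open>
  Only nonempty subfamilies can satisfy the hypothesis \<open>\<Inter> (\<G> i) = {}\<close>, because \<open>\<Inter> {} = UNIV\<close>.
  If the ground set \<open>X\<close> is nonempty, this agrees with the convention that the intersection of the empty
  subfamily is \<open>X\<close>; so the ground set plays no role here.
\<close>

definition colorful_Helly_property :: "'a set set \<Rightarrow> nat \<Rightarrow> bool" where
  "colorful_Helly_property \<F> n \<longleftrightarrow>
     (\<forall>\<G> :: nat \<Rightarrow> 'a set set.
        (\<forall>i\<in>{1..n}. finite (\<G> i) \<and> \<G> i \<subseteq> \<F> \<and> \<Inter> (\<G> i) = {}) \<longrightarrow>
        (\<exists>F :: nat \<Rightarrow> 'a set. (\<forall>i\<in>{1..n}. F i \<in> \<G> i) \<and> (\<Inter>i\<in>{1..n}. F i) = {}))"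

text \<open>In \<^typ>\<open>enat\<close> the infimum of a nonempty set is its minimum, and \<open>Inf {} = \<infinity>\<close>.\<close>

definition colorful_Helly_number :: "'a set set \<Rightarrow> enat" where
  "colorful_Helly_number \<F> = Inf {enat n | n. n \<ge> 1 \<and> colorful_Helly_property \<F> n}"

text \<open>
  Below, the supremum is the largest admissible \<open>k\<close>, or \<open>\<infinity>\<close> if the admissible \<open>k\<close> are unbounded.
  For \<open>comatching_number'\<close> no \<open>k\<close> at all is admissible if \<open>X = {}\<close>; then its value is \<open>Sup {} = 0\<close>.
\<close>

definition comatching_number :: "'a set \<Rightarrow> 'a set set \<Rightarrow> enat" where
  "comatching_number X \<F> = Sup {enat k | k. \<exists>(x :: nat \<Rightarrow> 'a) (F :: nat \<Rightarrow> 'a set).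
     (\<forall>i\<in>{1..k}. x i \<in> X) \<and> (\<forall>j\<in>{1..k}. F j \<in> \<F>) \<and>
     (\<forall>i\<in>{1..k}. \<forall>j\<in>{1..k}. x i \<in> F j \<longleftrightarrow> i \<noteq> j)}"

definition comatching_number' :: "'a set \<Rightarrow> 'a set set \<Rightarrow> enat" where
  "comatching_number' X \<F> = Sup {enat k | k. \<exists>(x :: nat \<Rightarrow> 'a) (F :: nat \<Rightarrow> 'a set).
     (\<forall>i\<in>{1..k+1}. x i \<in> X) \<and> (\<forall>j\<in>{1..k}. F j \<in> \<F>) \<and>
     (\<forall>i\<in>{1..k+1}. \<forall>j\<in>{1..k}. x i \<in> F j \<longleftrightarrow> i \<noteq> j)}"

end

theory Submission
  imports Defs "HOL-Library.FuncSet"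
begin

text \<open>
  The upper bound is an exchange argument. Suppose that \<open>n\<close> finite families \<open>\<G> 1, \<dots>, \<G> n\<close>, each with empty
  intersection, have only intersecting transversals. Among the finitely many transversals take one,
  \<open>F 1, \<dots>, F n\<close>, whose intersection is inclusion-minimal, and a point \<open>p\<close> in that intersection. Some member
  of \<open>\<G> j\<close> misses \<open>p\<close>. Exchanging \<open>F j\<close> for it removes \<open>p\<close> from the intersection, so by minimality
  the exchange must also bring in a new point, which lies in every \<open>F i\<close> with \<open>i \<noteq> j\<close> but not in \<open>F j\<close>. These \<open>n\<close>
  points, together with \<open>p\<close>, show that the primed comatching number is at least \<open>n\<close>
  (\<open>le_comatching_number'_if_not_colorful\<close>). Hence the colorful Helly property holds at one more than
  this number, when it is finite.

  For the equality, take a comatching \<open>x 1, \<dots>, x k\<close>, \<open>F 1, \<dots>, F k\<close> of maximum size, and assume that the primed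
  number is \<open>k - 1\<close>. Then \<open>F 1, \<dots>, F k\<close> have no common point, since such a point would extend the comatching
  to a primed one of size \<open>k\<close>. But fewer than \<open>k\<close> of these sets always share some \<open>x i\<close>, so fewer
  than \<open>k\<close> copies of the family \<open>{F 1, \<dots>, F k}\<close> violate the colorful Helly property.
\<close>

lemma le_comatching_number'_if_not_colorful:
  assumes sub: "\<F> \<subseteq> Pow X" and "n \<ge> 1" and "\<not> colorful_Helly_property \<F> n"
  shows "enat n \<le> comatching_number' X \<F>"
proof -
  obtain \<G> :: "nat \<Rightarrow> 'a set set" where
    \<G>: "\<forall>i\<in>{1..n}. finite (\<G> i) \<and> \<G> i \<subseteq> \<F> \<and> \<Inter> (\<G> i) = {}"
    and meets: "\<not> (\<exists>F. (\<forall>i\<in>{1..n}. F i \<in> \<G> i) \<and> (\<Inter>i\<in>{1..n}. F i) = {})"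
    using assms(3) unfolding colorful_Helly_property_def not_all not_imp by (elim exE conjE)
  define T where "T = PiE {1..n} \<G>"
  define C where "C F = (\<Inter>i\<in>{1..n}. F i)" for F :: "nat \<Rightarrow> 'a set"
  have "finite T"
    unfolding T_def by (rule finite_PiE) (use \<G> in blast)+
  moreover have "\<G> i \<noteq> {}" if "i \<in> {1..n}" for i
    using bspec[OF \<G> that] by auto
  then have "T \<noteq> {}"
    unfolding T_def by (simp add: PiE_eq_empty_iff)
  ultimately obtain F where F: "F \<in> T" and minimal: "\<And>F'. F' \<in> T \<Longrightarrow> C F' \<subseteq> C F \<Longrightarrow> C F' = C F"
    using finite_has_minimal[of "C ` T"] by auto
  have F_in: "F i \<in> \<G> i" if "i \<in> {1..n}" for i
    using F that unfolding T_def by auto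
  obtain p where p: "p \<in> C F"
    using meets F_in unfolding C_def by blast
  \<comment> \<open>The exchange at \<open>j\<close>; the point found lies in \<open>X\<close> because it lies in the exchanged-in set \<open>H\<close>, even when \<open>n = 1\<close>.\<close>
  have "\<exists>y\<in>X. \<forall>i\<in>{1..n}. y \<in> F i \<longleftrightarrow> j \<noteq> i" if j: "j \<in> {1..n}" for j
  proof -
    obtain H where H: "H \<in> \<G> j" "p \<notin> H"
      using bspec[OF \<G> j] by blast
    let ?F' = "F(j := H)"
    have "?F' \<in> T"
      using F H(1) j unfolding T_def by (auto simp: PiE_iff extensional_def)
    moreover have "p \<notin> C ?F'"
      using H(2) j unfolding C_def by force
    ultimately obtain y where y: "y \<in> C ?F'" "y \<notin> C F"
      using minimal p by blast
    have other: "y \<in> F i" if "i \<in> {1..n}" "i \<noteq> j" for i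
      using y(1) that unfolding C_def by force
    then have "y \<notin> F j"
      using y(2) unfolding C_def by blast
    moreover have "y \<in> H"
      using y(1) j unfolding C_def by force
    then have "y \<in> X"
      using H(1) bspec[OF \<G> j] sub by blast
    ultimately show ?thesis
      using other by blast
  qed
  then obtain y where y: "\<And>j. j \<in> {1..n} \<Longrightarrow> y j \<in> X"
      "\<And>j i. j \<in> {1..n} \<Longrightarrow> i \<in> {1..n} \<Longrightarrow> y j \<in> F i \<longleftrightarrow> j \<noteq> i"
    by metis
  let ?x = "y(n + 1 := p)"
  have pF: "p \<in> F i" if "i \<in> {1..n}" for i
    using p that unfolding C_def by blast
  have in_\<F>: "F i \<in> \<F>" if "i \<in> {1..n}" for i
    using F_in[OF that] bspec[OF \<G> that] by blast
  have "p \<in> X"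
    using pF[of 1] in_\<F>[of 1] sub \<open>n \<ge> 1\<close> by auto
  then have "\<forall>i\<in>{1..n+1}. ?x i \<in> X"
    using y(1) by auto
  moreover have "\<forall>i\<in>{1..n+1}. \<forall>j\<in>{1..n}. ?x i \<in> F j \<longleftrightarrow> i \<noteq> j"
    using y(2) pF by auto
  ultimately show ?thesis
    unfolding comatching_number'_def using in_\<F> by (intro Sup_upper) blast
qed

lemma comatching_number_attained:
  assumes "comatching_number X \<F> = enat k"
  obtains x F where "\<And>i. i \<in> {1..k} \<Longrightarrow> x i \<in> X" "\<And>j. j \<in> {1..k} \<Longrightarrow> F j \<in> \<F>"
    "\<And>i j. i \<in> {1..k} \<Longrightarrow> j \<in> {1..k} \<Longrightarrow> x i \<in> F j \<longleftrightarrow> i \<noteq> j"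
proof -
  define S where "S = {enat k | k. \<exists>(x :: nat \<Rightarrow> 'a) (F :: nat \<Rightarrow> 'a set).
     (\<forall>i\<in>{1..k}. x i \<in> X) \<and> (\<forall>j\<in>{1..k}. F j \<in> \<F>) \<and>
     (\<forall>i\<in>{1..k}. \<forall>j\<in>{1..k}. x i \<in> F j \<longleftrightarrow> i \<noteq> j)}"
  have Sup: "Sup S = enat k"
    using assms unfolding S_def comatching_number_def .
  have "S \<noteq> {}"
    unfolding S_def by (auto intro: exI[of _ 0])
  then have "enat k \<in> S"
    using Sup by (auto simp: Sup_enat_def split: if_splits dest: Max_in)
  then obtain x F where "\<forall>i\<in>{1..k}. x i \<in> X" "\<forall>j\<in>{1..k}. F j \<in> \<F>"
    "\<forall>i\<in>{1..k}. \<forall>j\<in>{1..k}. x i \<in> F j \<longleftrightarrow> i \<noteq> j"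
    unfolding S_def mem_Collect_eq enat.inject by blast
  then show ?thesis
    by (intro that) blast+
qed

text \<open>
  The counterexample to the property is \<open>n\<close> copies of the whole family \<open>{F 1, \<dots>, F k}\<close>: a transversal
  uses at most \<open>n < k\<close> of its members, so it omits some \<open>F m\<close>, and then \<open>x m\<close> is a common point.
\<close>

lemma not_colorful_if_comatching_without_common_point:
  assumes F: "\<And>j. j \<in> {1..k} \<Longrightarrow> F j \<in> \<F>"
    and x: "\<And>i j. i \<in> {1..k} \<Longrightarrow> j \<in> {1..k} \<Longrightarrow> x i \<in> F j \<longleftrightarrow> i \<noteq> j"
    and empty: "(\<Inter>j\<in>{1..k}. F j) = {}" and "n < k"
  shows "\<not> colorful_Helly_property \<F> n"
proof
  assume "colorful_Helly_property \<F> n"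
  then have "(\<forall>i\<in>{1..n}. finite (F ` {1..k}) \<and> F ` {1..k} \<subseteq> \<F> \<and> \<Inter> (F ` {1..k}) = {}) \<longrightarrow>
      (\<exists>H. (\<forall>i\<in>{1..n}. H i \<in> F ` {1..k}) \<and> (\<Inter>i\<in>{1..n}. H i) = {})"
    unfolding colorful_Helly_property_def by (rule spec[of _ "\<lambda>_. F ` {1..k}"])
  then obtain H where H: "\<forall>i\<in>{1..n}. H i \<in> F ` {1..k}" and H_empty: "(\<Inter>i\<in>{1..n}. H i) = {}"
    using F empty by auto
  have "\<forall>i\<in>{1..n}. \<exists>j. j \<in> {1..k} \<and> H i = F j"
    using H by blast
  then obtain c where c: "\<And>i. i \<in> {1..n} \<Longrightarrow> c i \<in> {1..k} \<and> H i = F (c i)"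
    unfolding bchoice_iff by blast
  have "card (c ` {1..n}) < card {1..k}"
    using card_image_le[of "{1..n}" c] \<open>n < k\<close> by simp
  then have "\<not> {1..k} \<subseteq> c ` {1..n}"
    using card_mono[of "c ` {1..n}" "{1..k}"] by auto
  then obtain m where m: "m \<in> {1..k}" "m \<notin> c ` {1..n}"
    by blast
  have "x m \<in> H i" if i: "i \<in> {1..n}" for i
  proof -
    have "m \<noteq> c i"
      using m(2) i by blast
    then show ?thesis
      using c[OF i] x[OF m(1), of "c i"] by simp
  qed
  then show False
    using H_empty by blast
qed

lemma colorful_Helly_number_le:
  assumes "\<F> \<subseteq> Pow X"
  shows "colorful_Helly_number \<F> \<le> 1 + comatching_number' X \<F>"
proof (cases "comatching_number' X \<F>")
  case (enat t)
  have "\<not> enat (t + 1) \<le> comatching_number' X \<F>"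
    using enat by simp
  then have "colorful_Helly_property \<F> (t + 1)"
    using le_comatching_number'_if_not_colorful[OF assms, of "t + 1"] by auto
  then have "colorful_Helly_number \<F> \<le> enat (t + 1)"
    unfolding colorful_Helly_number_def by (intro Inf_lower) auto
  then show ?thesis
    using enat by (simp add: one_enat_def)
qed simp

text \<open>
  The strict inequality in the hypothesis ensures that the sets of a maximum comatching have no common point.
\<close>

lemma comatching_number_le_colorful_Helly_number:
  assumes sub: "\<F> \<subseteq> Pow X" and k: "comatching_number X \<F> = enat k"
    and less: "comatching_number' X \<F> < enat k"
  shows "enat k \<le> colorful_Helly_number \<F>"
proof -
  obtain x F where x: "\<And>i. i \<in> {1..k} \<Longrightarrow> x i \<in> X" and F: "\<And>j. j \<in> {1..k} \<Longrightarrow> F j \<in> \<F>"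
    and xF: "\<And>i j. i \<in> {1..k} \<Longrightarrow> j \<in> {1..k} \<Longrightarrow> x i \<in> F j \<longleftrightarrow> i \<noteq> j"
    using comatching_number_attained[OF k] by metis
  have "k \<ge> 1"
    using less by (cases k) (auto simp: zero_enat_def[symmetric])
  have "(\<Inter>j\<in>{1..k}. F j) = {}"
  proof (rule ccontr)
    assume "(\<Inter>j\<in>{1..k}. F j) \<noteq> {}"
    then obtain p where p: "\<And>j. j \<in> {1..k} \<Longrightarrow> p \<in> F j"
      by blast
    have "p \<in> X"
      using p[of 1] F[of 1] sub \<open>k \<ge> 1\<close> by auto
    then have "\<forall>i\<in>{1..k+1}. (x(k + 1 := p)) i \<in> X"
      using x by auto
    moreover have "\<forall>i\<in>{1..k+1}. \<forall>j\<in>{1..k}. (x(k + 1 := p)) i \<in> F j \<longleftrightarrow> i \<noteq> j"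
      using xF p by auto
    ultimately have "enat k \<le> comatching_number' X \<F>"
      unfolding comatching_number'_def using F by (intro Sup_upper) blast
    then show False
      using less by simp
  qed
  then have "\<not> colorful_Helly_property \<F> n" if "n < k" for n
    using not_colorful_if_comatching_without_common_point[of k F \<F> x n] F xF that by blast
  then show ?thesis
    unfolding colorful_Helly_number_def by (intro Inf_greatest) (auto simp: not_less[symmetric])
qed

theorem theorem1p3:
  fixes X :: "'a set" and \<F> :: "'a set set"
  assumes "\<F> \<subseteq> Pow X"
  shows "colorful_Helly_number \<F> \<le> 1 + comatching_number' X \<F> \<and>
    (comatching_number X \<F> \<noteq> \<infinity> \<and> comatching_number' X \<F> + 1 = comatching_number X \<F> \<longrightarrow>
       colorful_Helly_number \<F> = 1 + comatching_number' X \<F> \<and>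
       1 + comatching_number' X \<F> = comatching_number X \<F>)"
proof (intro conjI impI; (elim conjE)?)
  show upper: "colorful_Helly_number \<F> \<le> 1 + comatching_number' X \<F>"
    by (rule colorful_Helly_number_le[OF assms])
  assume finite: "comatching_number X \<F> \<noteq> \<infinity>"
    and eq: "comatching_number' X \<F> + 1 = comatching_number X \<F>"
  show eq': "1 + comatching_number' X \<F> = comatching_number X \<F>"
    using eq by (simp add: add.commute)
  obtain k where k: "comatching_number X \<F> = enat k"
    using finite by auto
  have "comatching_number' X \<F> < enat k"
    using eq k by (cases "comatching_number' X \<F>") (auto simp: one_enat_def)
  then show "colorful_Helly_number \<F> = 1 + comatching_number' X \<F>"
    using comatching_number_le_colorful_Helly_number[OF assms k] upper eq' k by simp
qed

end
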